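(* Let $\mathcal{R}$ be a $\ast$-ring, let $a\in\mathcal{R}$, and let $n\geq 2$ and $k>n$ be integers. Then the following are equivalent: (i) $a$ is right core invertible; (ii) $\mathcal{R}a=\mathcal{R}a^{\ast}a$ and $a\mathcal{R}=a^{n}\mathcal{R}$; (iii) $\mathcal{R}a=\mathcal{R}(a^{\ast})^{n}a$; (iv) $\mathcal{R}a^n=\mathcal{R}(a^{\ast})^na^n$ and $a\mathcal{R}=a^{k}\mathcal{R}$.
   Context: A $\ast$-ring is an associative ring $\mathcal{R}$ with identity $1$ equipped with an involution, i.e. a map $\ast:\mathcal{R}\to\mathcal{R}$ with $(a^\ast)^\ast=a$, $(a+b)^\ast=a^\ast+b^\ast$, $(ab)^\ast=b^\ast a^\ast$ for all $a,b\in\mathcal{R}$. An element $a\in\mathcal{R}$ is right core invertible if $a^\ast\in a^\ast a^2\mathcal{R}$, equivalently if there exists $x\in a\mathcal{R}$ with $a^\ast a x=a^\ast$; any such $x$ is called a right core inverse of $a$ (not necessarily unique). *)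

theory Defs
  imports Main
begin

(* The sort {ring, monoid_mult} is used instead of ring_1 because ring_1 includes
   0 \<noteq> 1, which would exclude the zero ring. *)
class star_ring = ring + monoid_mult +
  fixes star :: "'a \<Rightarrow> 'a"  ("_\<^sup>\<star>" [1000] 999)
  assumes star_star: "(a\<^sup>\<star>)\<^sup>\<star> = a"
    and star_add: "(a + b)\<^sup>\<star> = a\<^sup>\<star> + b\<^sup>\<star>"
    and star_mult: "(a * b)\<^sup>\<star> = b\<^sup>\<star> * a\<^sup>\<star>"

definition right_principal :: "'a::star_ring \<Rightarrow> 'a set" where
  "right_principal a = {a * r | r. True}"

definition left_principal :: "'a::star_ring \<Rightarrow> 'a set" where
  "left_principal a = {r * a | r. True}"

definition right_core_invertible :: "'a::star_ring \<Rightarrow> bool" where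
  "right_core_invertible a \<longleftrightarrow> a\<^sup>\<star> \<in> right_principal (a\<^sup>\<star> * a ^ 2)"

lemma right_core_invertible_iff_right_core_inverse:
  "right_core_invertible a \<longleftrightarrow> (\<exists>x \<in> right_principal a. a\<^sup>\<star> * a * x = a\<^sup>\<star>)"
proof -
  have "a\<^sup>\<star> * a ^ 2 * r = a\<^sup>\<star> * a * (a * r)" for r
    by (simp add: power2_eq_square mult.assoc)
  then have "{a\<^sup>\<star> * a ^ 2 * r | r. True} = {a\<^sup>\<star> * a * (a * r) | r. True}"
    by simp
  then show ?thesis
    unfolding right_core_invertible_def right_principal_def by (auto simp: eq_commute)
qed

end

theory Submission
  imports Defs
begin

text \<open>
  Applying the involution turns \<open>R x = R y\<^sup>\<star> x\<close> into solvability of \<open>x\<^sup>\<star> = x\<^sup>\<star> y s\<close>, so all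
  conditions become equations starting with \<open>a\<^sup>\<star>\<close>. If \<open>a\<^sup>\<star> = a\<^sup>\<star> a b\<close> with \<open>b = a r\<close>, then
  \<open>a b\<close> is a projection fixing \<open>a\<close>, hence \<open>a = a b a = a\<^sup>2 r a\<close>; iterating this,
  \<open>a R = a\<^sup>m R\<close> for all \<open>m > 0\<close>. Writing \<open>a = a\<^sup>n t\<close> then allows one to trade \<open>a\<close> for \<open>a\<^sup>n\<close> inside
  the projection \<open>a b = a\<^sup>n t b\<close>.
\<close>

lemma star_one: "(1::'a::star_ring)\<^sup>\<star> = 1"
  by (metis mult_1_left mult_1_right star_mult star_star)

lemma star_power: "((a::'a::star_ring) ^ n)\<^sup>\<star> = (a\<^sup>\<star>) ^ n"
  by (induction n) (simp_all add: star_one star_mult power_commutes)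

text \<open>The left side amounts to \<open>x = r * (y\<^sup>\<star> * x)\<close> for some
  \<open>r\<close>, and the involution carries this to the right side with
  \<open>s = r\<^sup>\<star>\<close>. The pairs \<open>x\<close>, \<open>y\<close> used later are
  \<open>a\<close>, \<open>a\<close>, then \<open>a\<close>, \<open>a ^ n\<close>, then
  \<open>a ^ n\<close>, \<open>a ^ n\<close>.\<close>

lemma left_principal_eq_iff:
  fixes x y :: "'a::star_ring"
  shows "left_principal x = left_principal (y\<^sup>\<star> * x) \<longleftrightarrow> (\<exists>s. x\<^sup>\<star> = x\<^sup>\<star> * y * s)"
proof
  assume "left_principal x = left_principal (y\<^sup>\<star> * x)"
  moreover have "x \<in> left_principal x"
    unfolding left_principal_def by (metis (mono_tags) mem_Collect_eq mult_1_left)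
  ultimately obtain r where "x = r * (y\<^sup>\<star> * x)"
    unfolding left_principal_def by blast
  then have "x\<^sup>\<star> = (r * (y\<^sup>\<star> * x))\<^sup>\<star>" by simp
  then show "\<exists>s. x\<^sup>\<star> = x\<^sup>\<star> * y * s"
    by (auto simp: star_mult star_star)
next
  assume "\<exists>s. x\<^sup>\<star> = x\<^sup>\<star> * y * s"
  then obtain s where "x\<^sup>\<star> = x\<^sup>\<star> * y * s" ..
  then have "(x\<^sup>\<star>)\<^sup>\<star> = (x\<^sup>\<star> * y * s)\<^sup>\<star>" by simp
  then have x: "x = s\<^sup>\<star> * (y\<^sup>\<star> * x)"
    by (simp add: star_mult star_star)
  show "left_principal x = left_principal (y\<^sup>\<star> * x)"
  proof
    show "left_principal x \<subseteq> left_principal (y\<^sup>\<star> * x)"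
      unfolding left_principal_def using x by clarsimp (metis mult.assoc)
    show "left_principal (y\<^sup>\<star> * x) \<subseteq> left_principal x"
      unfolding left_principal_def by clarsimp (metis mult.assoc)
  qed
qed

lemma right_principal_power_eq_iff:
  fixes a :: "'a::star_ring"
  assumes "n > 0"
  shows "right_principal a = right_principal (a ^ n) \<longleftrightarrow> (\<exists>t. a = a ^ n * t)"
proof
  assume "right_principal a = right_principal (a ^ n)"
  moreover have "a \<in> right_principal a"
    unfolding right_principal_def by (metis (mono_tags) mem_Collect_eq mult_1_right)
  ultimately show "\<exists>t. a = a ^ n * t"
    unfolding right_principal_def by blast
next
  assume "\<exists>t. a = a ^ n * t"
  then obtain t where t: "a = a ^ n * t" ..
  have p: "a ^ n = a * a ^ (n - 1)"
    using assms by (metis power_eq_if not_gr_zero)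
  show "right_principal a = right_principal (a ^ n)"
  proof
    show "right_principal a \<subseteq> right_principal (a ^ n)"
      unfolding right_principal_def using t by clarsimp (metis mult.assoc)
    show "right_principal (a ^ n) \<subseteq> right_principal a"
      unfolding right_principal_def p by clarsimp (metis mult.assoc)
  qed
qed

lemma right_core_invertible_iff:
  "right_core_invertible a \<longleftrightarrow> (\<exists>r. a\<^sup>\<star> = a\<^sup>\<star> * a ^ 2 * r)"
  unfolding right_core_invertible_def right_principal_def by simp

text \<open>The right side depends on \<open>b\<close> only through the product
  \<open>x * b\<close>, so an equation for one element can be moved to another with the same
  projection.\<close>

lemma star_eq_star_mult_iff:
  fixes x b :: "'a::star_ring"
  shows "x\<^sup>\<star> = x\<^sup>\<star> * x * b \<longleftrightarrow> (x * b)\<^sup>\<star> = x * b \<and> x * b * x = x"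
proof
  assume eq: "x\<^sup>\<star> = x\<^sup>\<star> * x * b"
  \<comment> \<open>Substituting \<open>eq\<close> for \<open>x\<^sup>\<star>\<close> in
    \<open>b\<^sup>\<star> * x\<^sup>\<star>\<close> yields a visibly self-adjoint product.\<close>
  have h: "(x * b)\<^sup>\<star> = b\<^sup>\<star> * (x\<^sup>\<star> * x * b)"
    using eq by (simp add: star_mult)
  then have "((x * b)\<^sup>\<star>)\<^sup>\<star> = (b\<^sup>\<star> * (x\<^sup>\<star> * x * b))\<^sup>\<star>" by simp
  also have "\<dots> = b\<^sup>\<star> * (x\<^sup>\<star> * x * b)"
    by (simp add: star_mult star_star mult.assoc)
  finally have herm: "(x * b)\<^sup>\<star> = x * b"
    using h by (metis star_star)
  have "x = (x\<^sup>\<star> * (x * b))\<^sup>\<star>"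
    using eq by (metis mult.assoc star_star)
  then have "x * b * x = x"
    by (simp add: star_mult[of "x\<^sup>\<star>"] herm star_star)
  with herm show "(x * b)\<^sup>\<star> = x * b \<and> x * b * x = x" ..
next
  assume "(x * b)\<^sup>\<star> = x * b \<and> x * b * x = x"
  then show "x\<^sup>\<star> = x\<^sup>\<star> * x * b"
    by (metis mult.assoc star_mult)
qed

text \<open>Since \<open>a\<close> and \<open>u\<close> need not commute, the induction expands the
  rightmost \<open>a\<close> of the power, so that the new \<open>u\<close> lands next to
  \<open>u ^ m\<close>.\<close>

lemma power_factor_right:
  fixes a :: "'a::monoid_mult"
  assumes "a = a ^ 2 * u"
  shows "a = a ^ Suc m * u ^ m"
proof (induction m)
  case (Suc m)
  have "a ^ Suc m = a ^ m * a"
    by (rule power_Suc2)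
  also have "\<dots> = a ^ m * (a ^ 2 * u)"
    using assms by simp
  also have "\<dots> = a ^ Suc (Suc m) * u"
    by (metis add_2_eq_Suc' mult.assoc power_add)
  finally have "a ^ Suc m * u ^ m = a ^ Suc (Suc m) * u ^ Suc m"
    by (metis mult.assoc power_Suc)
  with Suc show ?case
    by simp
qed simp

lemma right_core_invertible_factor:
  fixes a :: "'a::star_ring"
  assumes "right_core_invertible a" and "n > 0"
  obtains b t where "a\<^sup>\<star> = a\<^sup>\<star> * a * b" and "a = a ^ n * t"
proof -
  obtain r where "a\<^sup>\<star> = a\<^sup>\<star> * a ^ 2 * r"
    using assms(1) right_core_invertible_iff by blast
  then have eq: "a\<^sup>\<star> = a\<^sup>\<star> * a * (a * r)"
    by (simp add: power2_eq_square mult.assoc)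
  then have "a * (a * r) * a = a"
    using star_eq_star_mult_iff by blast
  then have "a = a ^ 2 * (r * a)"
    by (simp add: power2_eq_square mult.assoc)
  then have "a = a ^ Suc (n - 1) * (r * a) ^ (n - 1)"
    by (rule power_factor_right)
  with eq assms(2) that show thesis by simp
qed

text \<open>The surplus factor \<open>a ^ (n - 2)\<close> is absorbed into the witness. This closes
  the converse direction of all three equivalences.\<close>

lemma right_core_invertibleI:
  fixes a :: "'a::star_ring"
  assumes "a\<^sup>\<star> = a\<^sup>\<star> * a ^ n * s" and "n \<ge> 2"
  shows "right_core_invertible a"
proof -
  have "a ^ n = a ^ 2 * a ^ (n - 2)"
    using assms(2) by (metis le_add_diff_inverse power_add)
  with assms(1) have "a\<^sup>\<star> = a\<^sup>\<star> * a ^ 2 * (a ^ (n - 2) * s)"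
    by (simp add: mult.assoc)
  then show ?thesis
    using right_core_invertible_iff by blast
qed

lemma right_core_invertible_iff_power_factor:
  fixes a :: "'a::star_ring"
  assumes "n \<ge> 2"
  shows "right_core_invertible a \<longleftrightarrow> (\<exists>s. a\<^sup>\<star> = a\<^sup>\<star> * a * s) \<and> (\<exists>t. a = a ^ n * t)"
proof
  assume "right_core_invertible a"
  then show "(\<exists>s. a\<^sup>\<star> = a\<^sup>\<star> * a * s) \<and> (\<exists>t. a = a ^ n * t)"
    using right_core_invertible_factor[of a n] assms
    by (metis less_le_trans zero_less_numeral)
next
  assume "(\<exists>s. a\<^sup>\<star> = a\<^sup>\<star> * a * s) \<and> (\<exists>t. a = a ^ n * t)"
  then obtain s t where s: "a\<^sup>\<star> = a\<^sup>\<star> * a * s" and t: "a = a ^ n * t" by blast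
  then have "a\<^sup>\<star> = a\<^sup>\<star> * a ^ n * (t * s)"
    by (metis mult.assoc)
  then show "right_core_invertible a"
    using assms by (rule right_core_invertibleI)
qed

lemma right_core_invertible_iff_star_power:
  fixes a :: "'a::star_ring"
  assumes "n \<ge> 2"
  shows "right_core_invertible a \<longleftrightarrow> (\<exists>s. a\<^sup>\<star> = a\<^sup>\<star> * a ^ n * s)"
proof
  assume "right_core_invertible a"
  then obtain s t where s: "a\<^sup>\<star> = a\<^sup>\<star> * a * s" and t: "a = a ^ n * t"
    using right_core_invertible_iff_power_factor[OF assms] by blast
  then have "a\<^sup>\<star> = a\<^sup>\<star> * a ^ n * (t * s)"
    by (metis mult.assoc)
  then show "\<exists>s. a\<^sup>\<star> = a\<^sup>\<star> * a ^ n * s" ..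
next
  assume "\<exists>s. a\<^sup>\<star> = a\<^sup>\<star> * a ^ n * s"
  then show "right_core_invertible a"
    using right_core_invertibleI assms by blast
qed

text \<open>Forward, \<open>a\<close> and \<open>a ^ n\<close> share the projection
  \<open>a * b\<close>. Backward, \<open>a\<close> lies in the right ideal of \<open>a ^ n\<close>
  because \<open>k \<ge> n\<close>, so the equation for \<open>(a ^ n)\<^sup>\<star>\<close> passes
  to \<open>a\<^sup>\<star>\<close>.\<close>

lemma right_core_invertible_iff_power:
  fixes a :: "'a::star_ring"
  assumes "n \<ge> 2" and "k \<ge> n"
  shows "right_core_invertible a \<longleftrightarrow>
    (\<exists>s. (a ^ n)\<^sup>\<star> = (a ^ n)\<^sup>\<star> * a ^ n * s) \<and> (\<exists>t. a = a ^ k * t)"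
proof
  assume rci: "right_core_invertible a"
  have "n > 0" "k > 0" using assms by simp_all
  obtain b t where b: "a\<^sup>\<star> = a\<^sup>\<star> * a * b" and t: "a = a ^ n * t"
    using right_core_invertible_factor[OF rci \<open>n > 0\<close>] .
  have herm: "(a * b)\<^sup>\<star> = a * b" and fix_a: "a * b * a = a"
    using b star_eq_star_mult_iff by blast+
  have p: "a ^ n = a * a ^ (n - 1)"
    using \<open>n > 0\<close> by (metis power_eq_if not_gr_zero)
  have ab: "a ^ n * (t * b) = a * b"
    using t by (metis mult.assoc)
  have "a * b * a ^ n = a ^ n"
    unfolding p using fix_a by (metis mult.assoc)
  \<comment> \<open>The criterion is applied with \<open>a ^ n\<close> for \<open>x\<close> and
    \<open>t * b\<close> for \<open>b\<close>: the product is again \<open>a * b\<close>, which is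
    self-adjoint and fixes \<open>a ^ n\<close>.\<close>
  with ab herm have "(a ^ n)\<^sup>\<star> = (a ^ n)\<^sup>\<star> * a ^ n * (t * b)"
    by (subst star_eq_star_mult_iff) simp
  moreover have "\<exists>t. a = a ^ k * t"
    using right_core_invertible_factor[OF rci \<open>k > 0\<close>] by metis
  ultimately show "(\<exists>s. (a ^ n)\<^sup>\<star> = (a ^ n)\<^sup>\<star> * a ^ n * s) \<and> (\<exists>t. a = a ^ k * t)"
    by blast
next
  assume "(\<exists>s. (a ^ n)\<^sup>\<star> = (a ^ n)\<^sup>\<star> * a ^ n * s) \<and> (\<exists>t. a = a ^ k * t)"
  then obtain s t where s: "(a ^ n)\<^sup>\<star> = (a ^ n)\<^sup>\<star> * a ^ n * s" and t: "a = a ^ k * t"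
    by blast
  define v where "v = a ^ (k - n) * t"
  have "a ^ k = a ^ n * a ^ (k - n)"
    using assms(2) by (metis le_add_diff_inverse power_add)
  with t have "a = a ^ n * v"
    by (simp add: v_def mult.assoc)
  then have v: "a\<^sup>\<star> = v\<^sup>\<star> * (a ^ n)\<^sup>\<star>"
    by (metis star_mult)
  \<comment> \<open>Multiply \<open>s\<close> on the left by \<open>v\<^sup>\<star>\<close> and use
    \<open>v\<close> on both sides.\<close>
  then have "a\<^sup>\<star> = a\<^sup>\<star> * a ^ n * s"
    using s by (metis mult.assoc)
  then show "right_core_invertible a"
    using assms(1) by (rule right_core_invertibleI)
qed

theorem corollary3p3:
  fixes a :: "'a::star_ring" and n k :: nat
  assumes "n \<ge> 2" and "k > n"
  shows "(right_core_invertible a \<longleftrightarrow>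
            left_principal a = left_principal (a\<^sup>\<star> * a) \<and>
            right_principal a = right_principal (a ^ n)) \<and>
         (right_core_invertible a \<longleftrightarrow>
            left_principal a = left_principal ((a\<^sup>\<star>) ^ n * a)) \<and>
         (right_core_invertible a \<longleftrightarrow>
            left_principal (a ^ n) = left_principal ((a\<^sup>\<star>) ^ n * a ^ n) \<and>
            right_principal a = right_principal (a ^ k))"
proof -
  have "n > 0" "k > 0" "k \<ge> n" using assms by simp_all
  note principal = left_principal_eq_iff right_principal_power_eq_iff[OF \<open>n > 0\<close>]
    right_principal_power_eq_iff[OF \<open>k > 0\<close>]
  show ?thesis
    \<comment> \<open>Rewriting powers of \<open>a\<^sup>\<star>\<close> as
      \<open>(a ^ n)\<^sup>\<star>\<close> exposes the shape \<open>y\<^sup>\<star> * x\<close> that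
      the left ideal criterion needs.\<close>
    unfolding star_power[symmetric] principal
    using right_core_invertible_iff_power_factor[OF assms(1), of a]
      right_core_invertible_iff_star_power[OF assms(1), of a]
      right_core_invertible_iff_power[OF assms(1) \<open>k \<ge> n\<close>, of a]
    by (intro conjI)
qed

end
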